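(* Let $N\ge1$, let $\bar\alpha_1=1$ and $$\bar\alpha_{k+1}=\frac{2}{1+\sqrt{1+\frac{4}{\bar\alpha_k^2}}}\qquad(k\ge1).$$ Then for any real numbers $a>0$ and $0<b<1$ such that $$a(1-b)\cdot 2^{2-b}-ab(1-b)\cdot2^{-b}-1\ge0,$$ one has $$\frac{2}{\left(1+a\cdot k^{-b}\right)k+1}<\bar\alpha_k\le\frac{2}{k+1},\qquad k=1,\dots,N.$$ *)

theory Defs
  imports Complex_Main
begin

end

theory Submission
  imports Defs
begin

text \<open>
  In terms of \<open>t k = 2 / \<alpha> k\<close> the recursion reads \<open>t (k + 1) = 1 + sqrt (1 + (t k)\<^sup>2)\<close> with \<open>t 1 = 2\<close>,
  and the claim becomes \<open>k + 1 \<le> t k < k + 1 + a k\<^sup>c\<close> for \<open>c = 1 - b\<close>. The left inequality is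
  immediate. The right one propagates if
  \<open>1 \<le> (a (k + 1)\<^sup>c - a k\<^sup>c) (2 k + 2 + a k\<^sup>c + a (k + 1)\<^sup>c)\<close>. By concavity of \<open>x\<^sup>c\<close> the right-hand side
  exceeds \<open>2 a c (k + 1)\<^sup>c \<ge> 2 a c 2\<^sup>c\<close>, which is at least \<open>1\<close> by the hypothesis on \<open>a\<close> and \<open>b\<close>.
\<close>

text \<open>Mean value theorem: since c \<le> 1, the derivative of \<open>x powr c\<close> is
  nonincreasing, so its value at the right endpoint is a lower bound.\<close>

lemma powr_add_one_diff_ge:
  fixes x c :: real
  assumes "0 < x" "0 \<le> c" "c \<le> 1"
  shows "c * (x + 1) powr (c - 1) \<le> (x + 1) powr c - x powr c"
proof -
  have "\<exists>z>x. z < x + 1 \<and>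
      (x + 1) powr c - x powr c = (x + 1 - x) * (c * z powr (c - 1))"
    using assms by (intro MVT2) (auto intro!: derivative_eq_intros simp: powr_diff)
  then obtain z where z: "x < z" "z < x + 1"
    and eq: "(x + 1) powr c - x powr c = c * z powr (c - 1)"
    by auto
  have "(x + 1) powr (c - 1) \<le> z powr (c - 1)"
    using z assms by (intro powr_mono2') auto
  then show ?thesis
    unfolding eq using assms by (intro mult_left_mono)
qed

lemma one_less_increment_product:
  fixes a c x :: real
  assumes "1 \<le> x" "0 < a" "0 < c" "c \<le> 1" and large: "1 \<le> 2 * a * c * 2 powr c"
  defines "f \<equiv> \<lambda>y. a * y powr c"
  shows "1 < (f (x + 1) - f x) * (2 * (x + 1) + f x + f (x + 1))"
proof -
  define d where "d = a * c * (x + 1) powr (c - 1)"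
  have d: "0 < d" "d \<le> f (x + 1) - f x"
    using assms powr_add_one_diff_ge[of x c]
    by (auto simp: d_def f_def mult.assoc simp flip: right_diff_distrib)
  have "2 powr c \<le> (x + 1) powr c"
    using assms by (intro powr_mono2) auto
  then have "2 * a * c * 2 powr c \<le> 2 * a * c * (x + 1) powr c"
    using assms by (intro mult_left_mono) auto
  also have "\<dots> = d * (2 * (x + 1))"
    using assms(1) by (simp add: d_def powr_diff field_simps)
  finally have "1 \<le> d * (2 * (x + 1))"
    using large by linarith
  \<comment> \<open>The strictness comes from here: \<open>large\<close> allows equality, but
    \<open>f x + f (x + 1)\<close> is positive.\<close>
  also have "\<dots> < d * (2 * (x + 1) + f x + f (x + 1))"
    using d assms by (intro mult_strict_left_mono) (auto simp: f_def add_pos_pos)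
  also have "\<dots> \<le> (f (x + 1) - f x) * (2 * (x + 1) + f x + f (x + 1))"
    using d assms by (intro mult_right_mono) (auto simp: f_def)
  finally show ?thesis .
qed

lemma sqrt_recursion_bounds:
  fixes t :: "nat \<Rightarrow> real" and a c :: real
  assumes "t 1 = 2"
    and rec: "\<And>k. k \<ge> 1 \<Longrightarrow> t (Suc k) = 1 + sqrt (1 + (t k)\<^sup>2)"
    and c: "0 < a" "0 < c" "c \<le> 1" "1 \<le> 2 * a * c * 2 powr c"
    and "k \<ge> 1"
  shows "real k + 1 \<le> t k \<and> t k < real k + 1 + a * real k powr c"
  using \<open>k \<ge> 1\<close>
proof (induction k rule: dec_induct)
  case base
  show ?case using assms by simp
next
  case (step k)
  define u v where "u = a * real k powr c" and "v = a * (real k + 1) powr c"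
  have tk: "real k + 1 \<le> t k" "t k < real k + 1 + u"
    using step by (auto simp: u_def)
  have "t k \<le> sqrt (1 + (t k)\<^sup>2)"
    by (rule real_le_rsqrt) simp
  moreover have "sqrt (1 + (t k)\<^sup>2) < real k + 1 + v"
  proof (rule real_less_lsqrt)
    have "(t k)\<^sup>2 \<le> (real k + 1 + u)\<^sup>2"
      using tk by (intro power_mono) auto
    \<comment> \<open>The right-hand side is the difference of the squares of
      \<open>real k + 1 + v\<close> and \<open>real k + 1 + u\<close>.\<close>
    moreover have "1 < (v - u) * (2 * (real k + 1) + u + v)"
      unfolding u_def v_def using step c by (intro one_less_increment_product) auto
    ultimately show "1 + (t k)\<^sup>2 < (real k + 1 + v)\<^sup>2"
      by (simp add: power2_eq_square algebra_simps)
  qed (use c in \<open>auto simp: v_def\<close>)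
  ultimately show ?case
    using tk rec[of k] step by (simp add: v_def add.commute)
qed

theorem theorem3:
  fixes N :: nat and \<alpha> :: "nat \<Rightarrow> real" and a b :: real
  assumes "N \<ge> 1"
    and "\<alpha> 1 = 1"
    and "\<And>k. k \<ge> 1 \<Longrightarrow> \<alpha> (k + 1) = 2 / (1 + sqrt (1 + 4 / (\<alpha> k)\<^sup>2))"
    and "a > 0" and "0 < b" and "b < 1"
    and "a * (1 - b) * 2 powr (2 - b) - a * b * (1 - b) * 2 powr (- b) - 1 \<ge> 0"
  shows "\<forall>k\<in>{1..N}. 2 / ((1 + a * real k powr (- b)) * real k + 1) < \<alpha> k
           \<and> \<alpha> k \<le> 2 / (real k + 1)"
proof
  fix k assume "k \<in> {1..N}"
  then have k: "k \<ge> 1" by simp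
  define t where "t k = 2 / \<alpha> k" for k
  have "2 powr (2 - b) = 2 * 2 powr (1 - b)"
    using powr_add[of 2 1 "1 - b"] by simp
  moreover have "0 \<le> a * b * (1 - b) * 2 powr (- b)"
    using assms by simp
  \<comment> \<open>For c = 1 - b, the first term of the hypothesis is
    \<open>2 * a * c * 2 powr c\<close>, and a nonnegative quantity is subtracted from it.\<close>
  ultimately have "1 \<le> 2 * a * (1 - b) * 2 powr (1 - b)"
    using assms(7) by (simp add: algebra_simps)
  then have t: "real k + 1 \<le> t k" "t k < real k + 1 + a * real k powr (1 - b)"
    using sqrt_recursion_bounds[of t a "1 - b" k] assms(2-6) k
    by (auto simp: t_def power_divide)
  have "(1 + a * real k powr (- b)) * real k + 1 = real k + 1 + a * real k powr (1 - b)"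
    using k powr_add[of "real k" "- b" 1] by (simp add: algebra_simps)
  \<comment> \<open>This inversion is valid even at zero because x / 0 = 0, so the substitution
    calls for no prior proof that \<open>\<alpha> k\<close> is nonzero.\<close>
  moreover have "\<alpha> k = 2 / t k"
    by (simp add: t_def)
  ultimately show "2 / ((1 + a * real k powr (- b)) * real k + 1) < \<alpha> k
      \<and> \<alpha> k \<le> 2 / (real k + 1)"
    using t by (auto intro!: divide_strict_left_mono divide_left_mono mult_pos_pos)
qed

end
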